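(* For all integers $n\ge0$ and $r\ge0$, the expected value of $X_{n+1,r}$ is $$\mathbb{E}X_{n+1,r}=\frac1{C_n}\biggl(\binom{2n}{n}+\sum_{j\ge0}\biggl(\binom{2n}{n-(j+1)(r+2)+1}-\binom{2n}{n-j(r+2)-1}\biggr)\biggr).$$
   Context: A plane tree is a finite rooted tree in which the children of every node are linearly ordered (from left to right); its size is its number of nodes. A path is a plane tree in which every node has at most one child (including the single-node tree). For a plane tree $\tau$, $\rho(\tau)$ is the plane tree obtained by cutting all old paths, i.e. by simultaneously deleting every non-root node $v$ such that $v$ is the leftmost child of its parent and the subtree of $\tau$ consisting of $v$ and all its descendants is a path; the single-node tree is mapped to itself. $X_{n,r}$ is the size of $\rho^r(\tau)$, where $\tau$ is chosen uniformly at random among all plane trees of size $n$. $C_n=\frac1{n+1}\binom{2n}n$. Binomial coefficients $\binom mk$ with $k<0$ are $0$. *)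

theory Defs
  imports "HOL-Probability.Probability"
begin

datatype plane_tree = Node "plane_tree list"

text \<open>The generated datatype size function does not count nodes, hence a separate function.\<close>

fun num_nodes :: "plane_tree \<Rightarrow> nat" where
  "num_nodes (Node ts) = 1 + (\<Sum>t\<leftarrow>ts. num_nodes t)"

fun is_path :: "plane_tree \<Rightarrow> bool" where
  "is_path (Node ts) \<longleftrightarrow> length ts \<le> 1 \<and> (\<forall>t\<in>set ts. is_path t)"

text \<open>
  Both cases of a node with children test the original subtree, so all old paths are deleted
  simultaneously: a child that becomes leftmost, or becomes a path, only through a deletion
  survives this round. When the leftmost child is the root of a path, all of its descendants are
  themselves leftmost children that root a path, so that whole subtree disappears. The root of
  the tree is never deleted.
\<close>

fun cut_old_paths :: "plane_tree \<Rightarrow> plane_tree" where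
  "cut_old_paths (Node []) = Node []"
| "cut_old_paths (Node (t # ts)) =
     (if is_path t then Node (map cut_old_paths ts)
      else Node (cut_old_paths t # map cut_old_paths ts))"

definition plane_trees :: "nat \<Rightarrow> plane_tree set" where
  "plane_trees n = {t. num_nodes t = n}"

definition random_plane_tree :: "nat \<Rightarrow> plane_tree pmf" where
  "random_plane_tree n = pmf_of_set (plane_trees n)"

text \<open>
  The random variable \<open>X\<^sub>n\<^sub>,\<^sub>r\<close>; the tree size \<open>n\<close> enters through the distribution
  \<^term>\<open>random_plane_tree n\<close>.
\<close>

definition X :: "nat \<Rightarrow> plane_tree \<Rightarrow> nat" where
  "X r t = num_nodes ((cut_old_paths ^^ r) t)"

definition catalan :: "nat \<Rightarrow> real" where
  "catalan n = real ((2 * n) choose n) / real (n + 1)"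

definition binom :: "nat \<Rightarrow> int \<Rightarrow> nat" where
  "binom m k = (if k < 0 then 0 else m choose nat k)"

text \<open>
  \<^const>\<open>pmf_of_set\<close> is the uniform distribution only on a finite nonempty set.
\<close>

lemma num_nodes_pos: "0 < num_nodes t"
  by (cases t) simp

lemma length_less_num_nodes: "length ts < num_nodes (Node ts)"
proof -
  have "length ts \<le> (\<Sum>t\<leftarrow>ts. num_nodes t)"
  proof (induction ts)
    case (Cons t ts)
    then show ?case using num_nodes_pos[of t] by simp
  qed simp
  then show ?thesis by simp
qed

lemma finite_plane_trees: "finite (plane_trees n)"
proof -
  have "finite {t. num_nodes t \<le> n}"
  proof (induction n)
    case 0
    have "{t. num_nodes t \<le> 0} = {}" using num_nodes_pos by auto
    then show ?case by (metis finite.emptyI)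
  next
    case (Suc n)
    have "{t. num_nodes t \<le> Suc n}
      \<subseteq> Node ` {ts. set ts \<subseteq> {t. num_nodes t \<le> n} \<and> length ts \<le> n}"
    proof
      fix t assume t: "t \<in> {t. num_nodes t \<le> Suc n}"
      obtain ts where ts: "t = Node ts" by (cases t)
      have "num_nodes s \<le> n" if "s \<in> set ts" for s
        using member_le_sum_list[of "num_nodes s" "map num_nodes ts"] that t ts by auto
      moreover have "length ts \<le> n" using length_less_num_nodes[of ts] t ts by simp
      ultimately show "t \<in> Node ` {ts. set ts \<subseteq> {t. num_nodes t \<le> n} \<and> length ts \<le> n}"
        using ts by auto
    qed
    with finite_lists_length_le[OF Suc, of n] show ?case
      by (meson finite_imageI finite_subset)
  qed
  then show ?thesis by (rule rev_finite_subset) (auto simp: plane_trees_def)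
qed

lemma plane_trees_nonempty: "plane_trees (Suc n) \<noteq> {}"
proof -
  have "num_nodes (Node (replicate n (Node []))) = Suc n"
    by (simp add: sum_list_replicate)
  then show ?thesis unfolding plane_trees_def by blast
qed

end

theory Submission
  imports Defs
begin

text \<open>
  Every tree with more than one node arises in exactly one way from a pair \<open>(s, t)\<close> by attaching
  \<open>t\<close> as the new last child of the root of \<open>s\<close>. This decomposition is compatible with cutting:
  old paths sit at the left end, so \<open>t\<close> is reached only after \<open>s\<close> has been reduced to its root.
  Hence the \<open>r\<close>-fold reduction of the combined tree is obtained by attaching the reduction of \<open>t\<close> to
  that of \<open>s\<close>, unless \<open>t\<close> is itself deleted, in which case everything except the root has gone
  (\<open>cut_pow_append_child\<close>). In particular sizes add up, with a correction of \<open>1\<close> exactly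
  for the trees that reduce to a single node (\<open>X_append_child\<close>).

  Let \<open>T\<close>, \<open>V r\<close> and \<open>F r\<close> be the power series, in a variable \<open>z\<close> marking nodes, that count all
  trees, the trees reduced to a single node by \<open>r\<close> rounds, and all trees weighted by \<open>X r\<close>. The
  decomposition turns into
  \<open>T = z + T\<^sup>2\<close>, \<open>V 0 = z\<close>, \<open>V (r + 1) = z + V r * V (r + 1)\<close> and
  \<open>F r = 2 z - V r + 2 T * F r\<close>. The last equation is linear and gives
  \<open>F r = (2 z - V r) / (1 - 2 T)\<close>.

  It remains to extract coefficients. The substitution \<open>z = u / (1 + u)\<^sup>2\<close>, that is
  \<open>T = u / (1 + u)\<close>, solves the continued fraction \<open>V (r + 1) = z / (1 - V r)\<close>:
  \<open>V r = z (1 + (u - u^(r+1)) / (1 - u^(r+2)))\<close>. Expanding the geometric series leaves a sum of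
  powers of \<open>u\<close>, and the coefficient of \<open>z^n\<close> in \<open>u^k / (1 - 2 T)\<close> is the binomial coefficient
  \<open>2n\<close> over \<open>n - k\<close> (\<open>u_power_D_nth\<close>). So each pair of binomial coefficients in the theorem
  comes from one term of that geometric series.
\<close>

section \<open>Cutting old paths and the last child\<close>

abbreviation leaf :: plane_tree where "leaf \<equiv> Node []"

fun append_child :: "plane_tree \<Rightarrow> plane_tree \<Rightarrow> plane_tree" where
  "append_child (Node ts) t = Node (ts @ [t])"

lemma append_child_neq_leaf [simp]: "append_child s t \<noteq> leaf"
  by (cases s) auto

lemma leaf_neq_append_child [simp]: "leaf \<noteq> append_child s t"
  using append_child_neq_leaf by metis

lemma append_child_inject [simp]: "append_child s t = append_child s' t' \<longleftrightarrow> s = s' \<and> t = t'"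
  by (cases s; cases s') auto

lemma append_child_cases:
  obtains "t = leaf" | s c where "t = append_child s c"
proof (cases t)
  case (Node ts)
  show ?thesis
    by (cases ts rule: rev_cases) (use Node that in auto, metis append_child.simps)
qed

lemma num_nodes_append_child [simp]:
  "num_nodes (append_child s t) = num_nodes s + num_nodes t"
  by (cases s) simp

lemma cut_eq_leaf_iff_is_path: "cut_old_paths t = leaf \<longleftrightarrow> is_path t"
  by (induction t rule: cut_old_paths.induct) auto

text \<open>
  If \<open>s\<close> has a child, then \<open>t\<close> is not leftmost and survives the round. If \<open>s\<close> is a leaf, then
  \<open>t\<close> is leftmost and is cut precisely when it is a path, i.e. when it reduces to a leaf.
\<close>

lemma cut_append_child:
  "cut_old_paths (append_child s t) =
    (if s = leaf \<and> cut_old_paths t = leaf then leaf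
     else append_child (cut_old_paths s) (cut_old_paths t))"
proof (cases s)
  case (Node ts)
  show ?thesis
    by (cases ts) (auto simp: Node cut_eq_leaf_iff_is_path)
qed

lemma cut_pow_leaf [simp]: "(cut_old_paths ^^ r) leaf = leaf"
  by (induction r) auto

text \<open>
  The shift of the exponent on \<open>s\<close> is the crux: within \<open>r + 1\<close> rounds \<open>t\<close> can be cut only if \<open>s\<close>
  has lost all its children one round earlier, since \<open>t\<close> must be leftmost at the start of the
  round that deletes it. For \<open>t\<close> to be a path at the start of that round means that it reduces to a
  leaf by the end of it.
\<close>

lemma cut_pow_append_child:
  "(cut_old_paths ^^ Suc r) (append_child s t) =
    (if (cut_old_paths ^^ r) s = leaf \<and> (cut_old_paths ^^ Suc r) t = leaf then leaf
     else append_child ((cut_old_paths ^^ Suc r) s) ((cut_old_paths ^^ Suc r) t))"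
proof (induction r)
  case 0
  show ?case by (simp add: cut_append_child)
next
  case (Suc r)
  show ?case
    by (subst funpow.simps(2), subst comp_apply, subst Suc.IH)
       (simp add: cut_append_child cut_eq_leaf_iff_is_path, auto simp: cut_eq_leaf_iff_is_path[symmetric])
qed

definition vanishes :: "nat \<Rightarrow> plane_tree \<Rightarrow> bool" where
  "vanishes r t \<longleftrightarrow> (cut_old_paths ^^ r) t = leaf"

lemma vanishes_leaf [simp]: "vanishes r leaf"
  by (simp add: vanishes_def)

lemma vanishes_0_append_child [simp]: "\<not> vanishes 0 (append_child s t)"
  by (simp add: vanishes_def)

lemma vanishes_Suc_append_child [simp]:
  "vanishes (Suc r) (append_child s t) \<longleftrightarrow> vanishes r s \<and> vanishes (Suc r) t"
  unfolding vanishes_def cut_pow_append_child by simp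

lemma vanishes_mono: "vanishes r t \<Longrightarrow> vanishes (Suc r) t"
  by (simp add: vanishes_def)

lemma X_eq_1_if_vanishes: "vanishes r t \<Longrightarrow> X r t = 1"
  by (simp add: X_def vanishes_def)

text \<open>
  When the combined tree vanishes, so do both parts, and their two roots are counted where only one
  is left; otherwise the sizes of the reduced parts simply add up.
\<close>

lemma X_append_child:
  "real (X r (append_child s t)) = real (X r s) + real (X r t) - of_bool (vanishes r (append_child s t))"
proof (cases r)
  case 0
  then show ?thesis by (simp add: X_def)
next
  case (Suc k)
  show ?thesis
  proof (cases "vanishes r (append_child s t)")
    case True
    then have "vanishes r s" "vanishes r t"
      using Suc vanishes_mono by auto
    with True show ?thesis by (simp add: X_eq_1_if_vanishes)
  next
    case False
    then have "X r (append_child s t) = X r s + X r t"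
      unfolding X_def Suc vanishes_def cut_pow_append_child by (auto split: if_splits)
    with False show ?thesis by simp
  qed
qed

section \<open>Generating functions of plane trees\<close>

definition tree_gf :: "(plane_tree \<Rightarrow> real) \<Rightarrow> real fps" where
  "tree_gf f = Abs_fps (\<lambda>n. \<Sum>t\<in>plane_trees n. f t)"

text \<open>
  The size of a pair is its total number of nodes, which is the size of the tree obtained by
  appending one component to the other.
\<close>

definition pair_gf :: "(plane_tree \<Rightarrow> plane_tree \<Rightarrow> real) \<Rightarrow> real fps" where
  "pair_gf h = Abs_fps (\<lambda>n. \<Sum>(s, t) | num_nodes s + num_nodes t = n. h s t)"

lemma tree_gf_nth: "fps_nth (tree_gf f) n = (\<Sum>t\<in>plane_trees n. f t)"
  by (simp add: tree_gf_def)

lemma pair_gf_add: "pair_gf (\<lambda>s t. g s t + h s t) = pair_gf g + pair_gf h"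
  by (rule fps_ext) (simp add: pair_gf_def case_prod_unfold sum.distrib)

lemma pair_gf_diff: "pair_gf (\<lambda>s t. g s t - h s t) = pair_gf g - pair_gf h"
  by (rule fps_ext) (simp add: pair_gf_def case_prod_unfold sum_subtractf)

lemma pairs_by_size:
  "{(s, t). num_nodes s + num_nodes t = n} = (\<Union>i\<in>{0..n}. plane_trees i \<times> plane_trees (n - i))"
  by (auto simp: plane_trees_def)

lemma pair_gf_mult: "pair_gf (\<lambda>s t. f s * g t) = tree_gf f * tree_gf g"
proof (rule fps_ext)
  fix n
  have "fps_nth (tree_gf f * tree_gf g) n
      = (\<Sum>i=0..n. \<Sum>(s, t)\<in>plane_trees i \<times> plane_trees (n - i). f s * g t)"
    by (simp add: fps_mult_nth tree_gf_nth sum_product sum.cartesian_product)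
  also have "\<dots> = (\<Sum>(s, t) | num_nodes s + num_nodes t = n. f s * g t)"
    unfolding pairs_by_size
    by (rule sum.UNION_disjoint[symmetric])
       (auto simp: finite_plane_trees, auto simp: plane_trees_def)
  finally show "fps_nth (pair_gf (\<lambda>s t. f s * g t)) n = fps_nth (tree_gf f * tree_gf g) n"
    by (simp add: pair_gf_def)
qed

lemma plane_trees_last_child:
  "plane_trees n = (if n = 1 then {leaf} else {}) \<union>
     (\<lambda>(s, t). append_child s t) ` {(s, t). num_nodes s + num_nodes t = n}"
proof (rule set_eqI)
  fix t
  show "t \<in> plane_trees n \<longleftrightarrow> t \<in> (if n = 1 then {leaf} else {}) \<union>
     (\<lambda>(s, t). append_child s t) ` {(s, t). num_nodes s + num_nodes t = n}"
    by (cases t rule: append_child_cases) (auto simp: plane_trees_def)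
qed

lemma tree_gf_last_child:
  "tree_gf f = fps_const (f leaf) * fps_X + pair_gf (\<lambda>s t. f (append_child s t))"
proof (rule fps_ext)
  fix n
  let ?Q = "{(s, t). num_nodes s + num_nodes t = n}"
  have fin: "finite ?Q"
    unfolding pairs_by_size by (auto simp: finite_plane_trees)
  have inj: "inj_on (\<lambda>(s, t). append_child s t) ?Q"
    by (auto simp: inj_on_def)
  have "fps_nth (tree_gf f) n = (\<Sum>t\<in>(if n = 1 then {leaf} else {}). f t)
      + (\<Sum>t\<in>(\<lambda>(s, t). append_child s t) ` ?Q. f t)"
    unfolding tree_gf_nth plane_trees_last_child[of n]
    by (rule sum.union_disjoint) (use fin in auto)
  also have "(\<Sum>t\<in>(\<lambda>(s, t). append_child s t) ` ?Q. f t) = (\<Sum>(s, t)\<in>?Q. f (append_child s t))"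
    by (subst sum.reindex[OF inj]) (simp add: case_prod_unfold)
  finally show "fps_nth (tree_gf f) n =
      fps_nth (fps_const (f leaf) * fps_X + pair_gf (\<lambda>s t. f (append_child s t))) n"
    by (simp add: pair_gf_def fps_X_def)
qed

definition T :: "real fps" where "T = tree_gf (\<lambda>_. 1)"

definition V :: "nat \<Rightarrow> real fps" where "V r = tree_gf (\<lambda>t. of_bool (vanishes r t))"

definition F :: "nat \<Rightarrow> real fps" where "F r = tree_gf (\<lambda>t. real (X r t))"

lemma T_eq: "T = fps_X + T * T"
  using tree_gf_last_child[of "\<lambda>_. 1"] pair_gf_mult[of "\<lambda>_. 1" "\<lambda>_. 1"] by (simp add: T_def)

lemma V_0: "V 0 = fps_X"
  unfolding V_def by (subst tree_gf_last_child) (simp add: pair_gf_def fps_zero_def[symmetric])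

lemma V_Suc: "V (Suc r) = fps_X + V r * V (Suc r)"
  unfolding V_def pair_gf_mult[symmetric]
  by (subst tree_gf_last_child) (simp add: of_bool_conj)

text \<open>
  The correction term in the recursion for \<open>X\<close> sums to the vanishing trees other than the leaf,
  which accounts for \<open>V r - fps_X\<close>; the two remaining terms are symmetric and give \<open>T * F r\<close> each.
\<close>

lemma F_eq: "F r = 2 * fps_X - V r + 2 * T * F r"
proof -
  have "F r = fps_X + pair_gf (\<lambda>s t. real (X r s) * 1 + 1 * real (X r t)
      - of_bool (vanishes r (append_child s t)))"
    unfolding F_def by (subst tree_gf_last_child) (simp add: X_eq_1_if_vanishes X_append_child)
  also have "\<dots> = fps_X + F r * T + T * F r
      - pair_gf (\<lambda>s t. of_bool (vanishes r (append_child s t)))"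
    unfolding pair_gf_diff pair_gf_add pair_gf_mult F_def T_def by simp
  also have "pair_gf (\<lambda>s t. of_bool (vanishes r (append_child s t))) = V r - fps_X"
    unfolding V_def using tree_gf_last_child[of "\<lambda>t. of_bool (vanishes r t)"] by simp
  finally show ?thesis by (simp add: algebra_simps)
qed

section \<open>Binomial coefficients as coefficients of powers\<close>

text \<open>
  Since \<open>T = (1 - sqrt (1 - 4 z)) / 2\<close>, this is \<open>1 / sqrt (1 - 4 z)\<close>, the generating function of
  the central binomial coefficients.
\<close>

definition D :: "real fps" where "D = inverse (1 - 2 * T)"

text \<open>
  The solution without constant term of \<open>z = u / (1 + u)\<^sup>2\<close>; equivalently \<open>T = u / (1 + u)\<close>.
\<close>

definition u :: "real fps" where "u = T * inverse (1 - T)"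

lemma plane_trees_0: "plane_trees 0 = {}"
  by (simp add: plane_trees_def num_nodes_pos[THEN less_imp_neq, THEN not_sym])

lemma T_nth_0 [simp]: "fps_nth T 0 = 0"
  by (simp add: T_def tree_gf_nth plane_trees_0)

lemma D_mult: "D * (1 - 2 * T) = 1"
  unfolding D_def by (rule inverse_mult_eq_1) simp

lemma one_plus_u: "(1 + u) * (1 - T) = 1"
proof -
  have "inverse (1 - T) * (1 - T) = 1" by (rule inverse_mult_eq_1) simp
  then show ?thesis unfolding u_def by (simp add: algebra_simps)
qed

lemma u_mult: "u * (1 - T) = T"
  using one_plus_u by (simp add: algebra_simps)

lemma X_one_plus_u: "fps_X * (1 + u) = T"
proof -
  have "fps_X = T * (1 - T)" using T_eq by (simp add: algebra_simps)
  then show ?thesis using one_plus_u by algebra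
qed

lemma X_one_plus_u_sq: "fps_X * (1 + u) ^ 2 = u"
proof -
  have "fps_X * (1 + u) ^ 2 = T * (1 + u)"
    unfolding power2_eq_square mult.assoc[symmetric] X_one_plus_u ..
  also have "\<dots> = u"
    using one_plus_u u_mult by algebra
  finally show ?thesis .
qed

lemma u_nth_0 [simp]: "fps_nth u 0 = 0"
  unfolding u_def by simp

lemma u_power_mult_nth_eq_0: "n < k \<Longrightarrow> fps_nth (u ^ k * g) n = 0"
  unfolding fps_mult_nth by (intro sum.neutral ballI) (simp add: startsby_zero_power_prefix)

lemma binom_Suc: "binom (Suc m) k = binom m k + binom m (k - 1)"
proof (cases "k \<le> 0")
  case True
  then show ?thesis by (auto simp: binom_def)
next
  case False
  then have "nat k = Suc (nat (k - 1))" by simp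
  then show ?thesis using False by (simp add: binom_def)
qed

lemma binom_symmetric: "binom m (int m - k) = binom m k"
proof (cases "0 \<le> k \<and> k \<le> int m")
  case True
  then have "nat (int m - k) = m - nat k" "nat k \<le> m" by auto
  then show ?thesis using True binomial_symmetric[of "nat k" m] by (auto simp: binom_def)
next
  case False
  then show ?thesis by (auto simp: binom_def)
qed

text \<open>
  Both sides satisfy the same recursion in \<open>n\<close>. On the right it is Pascal's rule applied twice; on
  the left it is \<open>u^k = z (1 + u)\<^sup>2 u^(k-1)\<close>. At \<open>k = 0\<close> the neighbour with index \<open>-1\<close> is folded
  back to index \<open>1\<close>, by the symmetry of binomial coefficients on the one side and by
  \<open>D = 1 + 2 T * D\<close> with \<open>T = z (1 + u)\<close> on the other.
\<close>

lemma u_power_D_nth: "fps_nth (u ^ k * D) n = real (binom (2 * n) (int n - int k))"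
proof (induction n arbitrary: k)
  case 0
  have "fps_nth D 0 = 1" by (simp add: D_def)
  then show ?case by (cases k) (auto simp: binom_def)
next
  case (Suc n)
  have pascal: "binom (2 * Suc n) (int (Suc n) - i) =
      binom (2 * n) (int n - (i - 1)) + 2 * binom (2 * n) (int n - i) + binom (2 * n) (int n - (i + 1))"
    for i
    using binom_Suc[of "2 * n"] binom_Suc[of "Suc (2 * n)"] by (simp add: algebra_simps)
  show ?case
  proof (cases k)
    case 0
    have "D = 1 + fps_X * (2 * D + 2 * (u * D))"
      using D_mult X_one_plus_u by algebra
    then have "fps_nth D (Suc n) = fps_nth (1 + fps_X * (2 * D + 2 * (u * D))) (Suc n)"
      by (rule arg_cong)
    also have "\<dots> = 2 * fps_nth (u ^ 0 * D) n + 2 * fps_nth (u ^ 1 * D) n"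
      by (simp add: numeral_fps_const)
    also have "\<dots> = 2 * real (binom (2 * n) (int n)) + 2 * real (binom (2 * n) (int n - 1))"
      unfolding Suc.IH by simp
    finally show ?thesis
      using pascal[of 0] binom_symmetric[of "2 * n" "int n - 1"] by (simp add: 0 algebra_simps)
  next
    case (Suc i)
    have "u ^ k * D = fps_X * (u ^ i * D + 2 * (u ^ Suc i * D) + u ^ Suc (Suc i) * D)"
    proof -
      have "u ^ k * D = fps_X * (1 + u) ^ 2 * (u ^ i * D)"
        unfolding X_one_plus_u_sq Suc by simp
      then show ?thesis by (simp add: power2_eq_square algebra_simps)
    qed
    then have "fps_nth (u ^ k * D) (Suc n) =
        fps_nth (u ^ i * D) n + 2 * fps_nth (u ^ Suc i * D) n + fps_nth (u ^ Suc (Suc i) * D) n"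
      by (simp add: numeral_fps_const)
    then show ?thesis
      unfolding Suc.IH using pascal[of "int k"] by (simp add: Suc algebra_simps)
  qed
qed

lemma D_nth: "fps_nth D n = real ((2 * n) choose n)"
  using u_power_D_nth[of 0 n] by (simp add: binom_def)

text \<open>
  Differentiating \<open>T = z + T\<^sup>2\<close> shows that the derivative of \<open>T\<close> is \<open>D\<close>, so the number of trees
  with \<open>n + 1\<close> nodes is the central binomial coefficient divided by \<open>n + 1\<close>.
\<close>

lemma card_plane_trees: "real (card (plane_trees (Suc n))) = catalan n"
proof -
  have "fps_deriv T = 1 + 2 * T * fps_deriv T"
    using arg_cong[OF T_eq, of fps_deriv] by (simp add: algebra_simps)
  then have "fps_deriv T = D"
    using D_mult by algebra
  then have "real (Suc n) * fps_nth T (Suc n) = real ((2 * n) choose n)"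
    using D_nth[of n] by (metis fps_deriv_nth Suc_eq_plus1)
  then show ?thesis
    by (simp add: T_def tree_gf_nth catalan_def field_simps)
qed

section \<open>Solving the continued fraction\<close>

text \<open>
  The recursion \<open>V (r + 1) = z / (1 - V r)\<close> is a continued fraction with constant numerators, so
  its convergents are quotients of terms of a linear recursion; in the variable \<open>u\<close> these terms are
  \<open>1 - u^k\<close> up to powers of \<open>1 + u\<close>. Clearing the denominator keeps the statement division-free.
\<close>

lemma V_closed_form: "V r * (1 - u ^ (r + 2)) = fps_X * (1 + u) * (1 - u ^ (r + 1))"
proof (induction r)
  case 0
  show ?case by (simp add: V_0 power2_eq_square algebra_simps)
next
  case (Suc r)
  have "(1 - V r) * ((1 + u) * (1 - u ^ (r + 2))) = 1 - u ^ (r + 3)"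
  proof -
    have "(1 - V r) * ((1 + u) * (1 - u ^ (r + 2))) =
        (1 + u) * (1 - u ^ (r + 2)) - (1 + u) * (V r * (1 - u ^ (r + 2)))"
      by (simp only: left_diff_distrib mult_1_left mult.left_commute[of "V r"])
    also have "(1 + u) * (V r * (1 - u ^ (r + 2))) = fps_X * (1 + u) ^ 2 * (1 - u ^ (r + 1))"
      unfolding Suc.IH power2_eq_square by (simp only: mult_ac)
    finally show ?thesis
      unfolding X_one_plus_u_sq by (simp add: algebra_simps eval_nat_numeral)
  qed
  moreover have "V (Suc r) * (1 - V r) = fps_X"
    using V_Suc[of r] by (simp add: algebra_simps)
  ultimately have "V (Suc r) * (1 - u ^ (r + 3)) = fps_X * ((1 + u) * (1 - u ^ (r + 2)))"
    by (metis mult.assoc)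
  then show ?case by (simp add: mult.assoc eval_nat_numeral)
qed

text \<open>
  The geometric series in \<open>u^(r+2)\<close> may be stopped at \<open>j = n\<close>: its remainder is divisible by
  \<open>u^((r+2)(n+1))\<close> and so does not reach the coefficient of \<open>z^n\<close>.
\<close>

lemma V_D_nth:
  "fps_nth (V r * D) (Suc n) = real ((2 * n) choose n) +
     (\<Sum>j\<le>n. real (binom (2 * n) (int n - int j * (int r + 2) - 1))
            - real (binom (2 * n) (int n - (int j + 1) * (int r + 2) + 1)))"
proof -
  define m where "m = r + 2"
  define q where "q = inverse (1 - u ^ m)"
  have q: "q * (1 - u ^ m) = 1"
    unfolding q_def by (rule inverse_mult_eq_1) (simp add: m_def)
  let ?S = "\<Sum>j\<le>n. (u ^ m) ^ j"
  have geometric: "q = ?S + u ^ (m * Suc n) * q"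
  proof -
    have "(1 - u ^ m) * ?S = 1 - u ^ (m * Suc n)"
      using one_diff_power_eq[of "u ^ m" "Suc n"] by (simp only: lessThan_Suc_atMost power_mult)
    then have "q * (1 - u ^ m) * ?S = q * (1 - u ^ (m * Suc n))"
      by (simp only: mult.assoc)
    then show ?thesis unfolding q by (simp add: algebra_simps)
  qed
  have V: "V r = fps_X * (1 + (u - u ^ (r + 1)) * q)"
  proof -
    have "V r = V r * (1 - u ^ m) * q"
      using q by (simp only: mult.assoc mult.commute[of "1 - u ^ m" q] mult_1_right)
    also have "\<dots> = fps_X * ((1 + u) * (1 - u ^ (r + 1)) * q)"
      unfolding m_def V_closed_form by (simp add: mult.assoc)
    also have "(1 + u) * (1 - u ^ (r + 1)) = (1 - u ^ m) + (u - u ^ (r + 1))"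
      by (simp add: m_def algebra_simps)
    also have "((1 - u ^ m) + (u - u ^ (r + 1))) * q = 1 + (u - u ^ (r + 1)) * q"
      using q by (simp only: distrib_right mult.commute[of "1 - u ^ m" q])
    finally show ?thesis .
  qed
  have expand: "(1 + (u - u ^ (r + 1)) * q) * D =
      D + (\<Sum>j\<le>n. u ^ (j * m + 1) * D - u ^ (j * m + r + 1) * D)
      + u ^ (m * Suc n) * (q * (u - u ^ (r + 1)) * D)"
  proof -
    have terms: "(u - u ^ (r + 1)) * ?S * D =
        (\<Sum>j\<le>n. u ^ (j * m + 1) * D - u ^ (j * m + r + 1) * D)"
      unfolding sum_distrib_left sum_distrib_right
      by (intro sum.cong refl) (simp add: power_add power_mult[symmetric] algebra_simps)
    have "(1 + (u - u ^ (r + 1)) * q) * D =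
        D + (u - u ^ (r + 1)) * (?S + u ^ (m * Suc n) * q) * D"
      by (simp only: geometric[symmetric] distrib_right mult_1_left)
    also have "\<dots> = D + (u - u ^ (r + 1)) * ?S * D
        + u ^ (m * Suc n) * (q * (u - u ^ (r + 1)) * D)"
      by (simp only: distrib_left distrib_right mult_ac add_ac)
    finally show ?thesis unfolding terms .
  qed
  have tail: "fps_nth (u ^ (m * Suc n) * (q * (u - u ^ (r + 1)) * D)) n = 0"
    by (rule u_power_mult_nth_eq_0) (simp add: m_def)
  \<comment> \<open>The factor \<open>fps_X\<close> of \<open>V r\<close> absorbs the shift from \<open>n + 1\<close> to \<open>n\<close>.\<close>
  have "fps_nth (V r * D) (Suc n) = fps_nth ((1 + (u - u ^ (r + 1)) * q) * D) n"
    unfolding V by (simp add: mult.assoc)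
  also have "\<dots> = real ((2 * n) choose n) +
      (\<Sum>j\<le>n. real (binom (2 * n) (int n - int (j * m + 1)))
             - real (binom (2 * n) (int n - int (j * m + r + 1))))"
    unfolding expand fps_add_nth tail fps_sum_nth fps_sub_nth u_power_D_nth D_nth by simp
  also have "\<dots> = real ((2 * n) choose n) +
     (\<Sum>j\<le>n. real (binom (2 * n) (int n - int j * (int r + 2) - 1))
            - real (binom (2 * n) (int n - (int j + 1) * (int r + 2) + 1)))"
    by (simp add: m_def algebra_simps)
  finally show ?thesis .
qed

section \<open>The expected size\<close>

lemma F_closed_form: "F r = (2 * fps_X - V r) * D"
  using F_eq[of r] D_mult by algebra

theorem corollary5p5:
  fixes n r :: nat
  shows "measure_pmf.expectation (random_plane_tree (n + 1)) (\<lambda>t. real (X r t)) =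
    1 / catalan n *
      (real ((2 * n) choose n) +
       (\<Sum>j. real (binom (2 * n) (int n - (int j + 1) * (int r + 2) + 1))
            - real (binom (2 * n) (int n - int j * (int r + 2) - 1))))"
proof -
  let ?a = "\<lambda>j. real (binom (2 * n) (int n - (int j + 1) * (int r + 2) + 1))"
  let ?b = "\<lambda>j. real (binom (2 * n) (int n - int j * (int r + 2) - 1))"
  \<comment> \<open>For \<open>j > n\<close> both lower indices are negative, so the series is a finite sum.\<close>
  have "?a j - ?b j = 0" if "j \<notin> {..n}" for j
  proof -
    have "int n < int j" using that by simp
    also have "\<dots> \<le> int j * (int r + 2)"
      using mult_left_mono[of 1 "int r + 2" "int j"] by simp
    finally have "int n < int j * (int r + 2)" .
    moreover have "(int j + 1) * (int r + 2) = int j * (int r + 2) + int r + 2"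
      by (simp add: distrib_right)
    ultimately have "int n - (int j + 1) * (int r + 2) + 1 < 0" "int n - int j * (int r + 2) - 1 < 0"
      by linarith+
    then show ?thesis by (simp only: binom_def if_True diff_self)
  qed
  then have series: "(\<Sum>j. ?a j - ?b j) = (\<Sum>j\<le>n. ?a j - ?b j)"
    by (intro suminf_finite) auto
  have "(\<Sum>t\<in>plane_trees (Suc n). real (X r t)) = fps_nth (F r) (Suc n)"
    by (simp add: F_def tree_gf_nth)
  also have "\<dots> = 2 * fps_nth D n - fps_nth (V r * D) (Suc n)"
    unfolding F_closed_form left_diff_distrib by (simp add: mult.assoc numeral_fps_const)
  also have "\<dots> = real ((2 * n) choose n) + (\<Sum>j. ?a j - ?b j)"
    unfolding series V_D_nth D_nth by (simp add: sum_subtractf)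
  finally have "(\<Sum>t\<in>plane_trees (Suc n). real (X r t)) =
      real ((2 * n) choose n) + (\<Sum>j. ?a j - ?b j)" .
  then show ?thesis
    using plane_trees_nonempty[of n] finite_plane_trees[of "Suc n"]
    by (simp add: random_plane_tree_def integral_pmf_of_set card_plane_trees)
qed

end
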